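(* $\mathsf{NORM}=\mathsf{NORM}_\varrho$ for all real numbers $\varrho$ in the closed interval $[-1,1]$.
   Context: Let $\mathsf{NORM}$ be the class of all real normed vector spaces. Let $(X,\|\cdot\|)\in\mathsf{NORM}$ and $\varrho\in\mathbb{R}$. For $\vec x,\vec y\in X\setminus\{\vec 0\}$ put $\mathbf{s}=\left\|\frac{\vec x}{\|\vec x\|}+\frac{\vec y}{\|\vec y\|}\right\|$, $\mathbf{d}=\left\|\frac{\vec x}{\|\vec x\|}-\frac{\vec y}{\|\vec y\|}\right\|$, $\mathbf{\Sigma}=\mathbf{s}^2+\mathbf{d}^2$ (which is $>0$), $\mathbf{\Delta}=\mathbf{s}^2-\mathbf{d}^2$, and $\langle\vec x\,|\,\vec y\rangle_\varrho=\|\vec x\|\cdot\|\vec y\|\cdot\frac14\mathbf{\Delta}\cdot\left(\frac14\mathbf{\Sigma}\right)^{\varrho}$; put $\langle\vec x\,|\,\vec y\rangle_\varrho=0$ if $\vec x=\vec 0$ or $\vec y=\vec 0$. The space $(X,\|\cdot\|)$ "has the angle $\angle_\varrho$" if $|\langle\vec x\,|\,\vec y\rangle_\varrho|\le\|\vec x\|\cdot\|\vec y\|$ for all $\vec x,\vec y\in X$, i.e. if the angle $\angle_\varrho(\vec x,\vec y):=\arccos\frac{\langle\vec x|\vec y\rangle_\varrho}{\|\vec x\|\|\vec y\|}$ is defined for all $\vec x,\vec y\ne\vec 0$. $\mathsf{NORM}_\varrho$ is the class of all real normed vector spaces that have the angle $\angle_\varrho$. *)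

theory Defs
  imports Complex_Main
begin

(* The vector space X is the type 'a of class real_vector, and a normed space (X, N) is given by
   its norm N. So NORM is the set of all normed spaces with underlying vector space 'a, and
   statements about the class of all real normed spaces are polymorphic in 'a. The three
   conditions are the axioms of the type class real_normed_vector. *)
definition NORM :: "('a::real_vector \<Rightarrow> real) set" where
  "NORM = {N. (\<forall>x. N x = 0 \<longleftrightarrow> x = 0) \<and>
              (\<forall>x y. N (x + y) \<le> N x + N y) \<and>
              (\<forall>a x. N (a *\<^sub>R x) = \<bar>a\<bar> * N x)}"

lemma NORM_iff_class_axioms:
  "N \<in> NORM \<longleftrightarrow> class.real_normed_vector_axioms N (+) 0 scaleR"
  by (auto simp: NORM_def class.real_normed_vector_axioms_def)

lemma norm_in_NORM: "(norm :: 'a::real_normed_vector \<Rightarrow> real) \<in> NORM"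
  by (simp add: NORM_def norm_triangle_ineq)

definition s_diag :: "('a::real_vector \<Rightarrow> real) \<Rightarrow> 'a \<Rightarrow> 'a \<Rightarrow> real" where
  "s_diag N x y = N (x /\<^sub>R N x + y /\<^sub>R N y)"

definition d_diag :: "('a::real_vector \<Rightarrow> real) \<Rightarrow> 'a \<Rightarrow> 'a \<Rightarrow> real" where
  "d_diag N x y = N (x /\<^sub>R N x - y /\<^sub>R N y)"

definition Sigma_diag :: "('a::real_vector \<Rightarrow> real) \<Rightarrow> 'a \<Rightarrow> 'a \<Rightarrow> real" where
  "Sigma_diag N x y = (s_diag N x y)\<^sup>2 + (d_diag N x y)\<^sup>2"

definition Delta_diag :: "('a::real_vector \<Rightarrow> real) \<Rightarrow> 'a \<Rightarrow> 'a \<Rightarrow> real" where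
  "Delta_diag N x y = (s_diag N x y)\<^sup>2 - (d_diag N x y)\<^sup>2"

(* For N in NORM and nonzero x, y the base of powr is positive. *)
definition rho_product :: "('a::real_vector \<Rightarrow> real) \<Rightarrow> real \<Rightarrow> 'a \<Rightarrow> 'a \<Rightarrow> real" where
  "rho_product N \<rho> x y =
     (if x = 0 \<or> y = 0 then 0
      else N x * N y * (1 / 4 * Delta_diag N x y) * (1 / 4 * Sigma_diag N x y) powr \<rho>)"

definition has_angle :: "('a::real_vector \<Rightarrow> real) \<Rightarrow> real \<Rightarrow> bool" where
  "has_angle N \<rho> \<longleftrightarrow> (\<forall>x y. \<bar>rho_product N \<rho> x y\<bar> \<le> N x * N y)"

definition NORM_angle :: "real \<Rightarrow> ('a::real_vector \<Rightarrow> real) set" where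
  "NORM_angle \<rho> = {N \<in> NORM. has_angle N \<rho>}"

end

theory Submission
  imports Defs
begin

text \<open>
  After normalisation the claim is \<open>\<bar>\<Delta>/4\<bar> (\<Sigma>/4)\<^sup>\<rho> \<le> 1\<close>, where \<open>s\<^sup>2\<close> and \<open>d\<^sup>2\<close> lie in \<open>[0, 4]\<close> because the
  diagonals of a parallelogram with unit sides have length at most 2. The two endpoints of the
  range of \<open>\<rho>\<close> are immediate: for \<open>\<rho> = -1\<close> the bound reads \<open>\<bar>\<Delta>\<bar> \<le> \<Sigma>\<close>, and for \<open>\<rho> = 1\<close> it reads
  \<open>\<bar>s\<^sup>4 - d\<^sup>4\<bar> \<le> 16\<close>. The other exponents follow since, for a fixed base, a power is a monotone
  function of its exponent, so \<open>(\<Sigma>/4)\<^sup>\<rho>\<close> is at most its value at one of the endpoints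
  (\<open>powr_le_max_endpoints\<close>, \<open>diagonal_bound\<close>).
\<close>

lemma powr_le_max_endpoints:
  fixes t r :: real
  assumes "t > 0" "r \<in> {-1..1}"
  shows "t powr r \<le> max t (inverse t)"
proof (cases "t \<ge> 1")
  case True
  then have "t powr r \<le> t powr 1"
    using assms by (intro powr_mono) auto
  then show ?thesis using assms by simp
next
  case False
  then have "t powr r \<le> t powr (-1)"
    using assms by (intro powr_mono') auto
  then show ?thesis using assms by (simp add: powr_minus)
qed

text \<open>
  The variables \<open>a\<close> and \<open>b\<close> stand for \<open>s\<^sup>2\<close> and \<open>d\<^sup>2\<close>; the two alternatives for the maximum are the
  cases \<open>\<rho> = 1\<close> and \<open>\<rho> = -1\<close>.
\<close>

lemma diagonal_bound:
  fixes a b r :: real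
  assumes a: "0 \<le> a" "a \<le> 4" and b: "0 \<le> b" "b \<le> 4" and r: "r \<in> {-1..1}"
  shows "\<bar>1 / 4 * (a - b)\<bar> * (1 / 4 * (a + b)) powr r \<le> 1"
proof (cases "a + b = 0")
  case True
  then show ?thesis by simp
next
  case False
  define p q where "p = a / 4" and "q = b / 4"
  have pq: "0 \<le> p" "p \<le> 1" "0 \<le> q" "q \<le> 1" and pos: "p + q > 0"
    using a b False by (auto simp: p_def q_def)
  have sq: "p\<^sup>2 \<le> 1" "q\<^sup>2 \<le> 1"
    using pq by (simp_all add: power_le_one)
  have "\<bar>p - q\<bar> * (p + q) = \<bar>(p - q) * (p + q)\<bar>"
    using pos by (simp add: abs_mult)
  also have "\<dots> = \<bar>p\<^sup>2 - q\<^sup>2\<bar>"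
    by (simp add: power2_eq_square algebra_simps)
  also have "\<dots> \<le> 1"
    using sq zero_le_power2[of p] zero_le_power2[of q] by linarith
  finally have upper: "\<bar>p - q\<bar> * (p + q) \<le> 1" .
  have "\<bar>p - q\<bar> \<le> p + q"
    using pq by linarith
  then have lower: "\<bar>p - q\<bar> * inverse (p + q) \<le> 1"
    using pos by (simp add: field_simps)
  have "\<bar>p - q\<bar> * (p + q) powr r \<le> \<bar>p - q\<bar> * max (p + q) (inverse (p + q))"
    using powr_le_max_endpoints[OF pos r] by (intro mult_left_mono) auto
  also have "\<dots> \<le> 1"
    using upper lower by (auto simp: max_def)
  finally show ?thesis
    by (simp add: p_def q_def diff_divide_distrib add_divide_distrib)
qed

lemma NORM_nonneg:
  assumes "N \<in> NORM"
  shows "N x \<ge> 0"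
proof -
  have add: "N (x + - x) \<le> N x + N (- x)"
    using assms unfolding NORM_def by blast
  have "N ((-1) *\<^sub>R x) = \<bar>-1\<bar> * N x" "N 0 = 0"
    using assms unfolding NORM_def by blast+
  with add show ?thesis by simp
qed

lemma NORM_normalized:
  assumes "N \<in> NORM" "x \<noteq> 0"
  shows "N (x /\<^sub>R N x) = 1"
proof -
  have "N x \<noteq> 0" "N (x /\<^sub>R N x) = \<bar>inverse (N x)\<bar> * N x"
    using assms by (auto simp: NORM_def)
  then show ?thesis
    using NORM_nonneg[OF assms(1), of x] by simp
qed

lemma diagonals_le_2:
  assumes "N \<in> NORM" "x \<noteq> 0" "y \<noteq> 0"
  shows "s_diag N x y \<le> 2" "d_diag N x y \<le> 2"
proof -
  define u v where "u = x /\<^sub>R N x" and "v = y /\<^sub>R N y"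
  have unit: "N u = 1" "N v = 1"
    using assms by (auto simp: u_def v_def NORM_normalized)
  have "N ((-1) *\<^sub>R v) = \<bar>-1\<bar> * N v" "N (u + v) \<le> N u + N v" "N (u + - v) \<le> N u + N (- v)"
    using assms(1) unfolding NORM_def by blast+
  then show "s_diag N x y \<le> 2" "d_diag N x y \<le> 2"
    using unit by (simp_all add: s_diag_def d_diag_def flip: u_def v_def)
qed

lemma diagonals_nonneg:
  assumes "N \<in> NORM"
  shows "s_diag N x y \<ge> 0" "d_diag N x y \<ge> 0"
  using NORM_nonneg[OF assms] by (simp_all add: s_diag_def d_diag_def)

lemma abs_rho_product_le:
  assumes N: "N \<in> NORM" and "\<rho> \<in> {-1..1}"
  shows "\<bar>rho_product N \<rho> x y\<bar> \<le> N x * N y"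
proof (cases "x = 0 \<or> y = 0")
  case True
  then show ?thesis
    using NORM_nonneg[OF N] by (auto simp: rho_product_def)
next
  case False
  then have "(s_diag N x y)\<^sup>2 \<le> 2\<^sup>2" "(d_diag N x y)\<^sup>2 \<le> 2\<^sup>2"
    using diagonals_le_2[OF N] diagonals_nonneg[OF N] by (intro power_mono; simp)+
  then have "\<bar>1 / 4 * Delta_diag N x y\<bar> * (1 / 4 * Sigma_diag N x y) powr \<rho> \<le> 1"
    unfolding Delta_diag_def Sigma_diag_def using assms by (intro diagonal_bound) auto
  then have "N x * N y * (\<bar>1 / 4 * Delta_diag N x y\<bar> * (1 / 4 * Sigma_diag N x y) powr \<rho>)
      \<le> N x * N y * 1"
    using NORM_nonneg[OF N] by (intro mult_left_mono) auto
  then show ?thesis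
    using False NORM_nonneg[OF N] by (simp add: rho_product_def abs_mult mult.assoc)
qed

theorem corollary1:
  fixes \<rho> :: real
  assumes "\<rho> \<in> {-1..1}"
  shows "(NORM :: ('a::real_vector \<Rightarrow> real) set) = NORM_angle \<rho>"
  using abs_rho_product_le[OF _ assms] by (auto simp: NORM_angle_def has_angle_def)

end
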